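(* Let $\mathfrak{B}$ be a temporal structure in which the relation $<$ is primitive positive definable. Then exactly one of the following two statements is true: (1) $\mathfrak{B}$ admits a primitive positive definition of $\mathrm{R}_{\min}$ or of $-\mathrm{R}_{\min}$; (2) $\mathfrak{B}$ is preserved by every binary injective operation on $\mathbb{Q}$ that preserves $\le$.
   Context: A temporal structure is a relational structure with domain $\mathbb{Q}$ and a finite relational signature all of whose relations are first-order definable in $(\mathbb{Q};<)$. A relation is primitive positive definable in $\mathfrak{B}$ if it is definable by a formula $\exists\bar x(\phi_1\wedge\dots\wedge\phi_m)$ with each $\phi_i$ atomic. $\mathrm{R}_{\min}=\{(x,y,z)\in\mathbb{Q}^3 : y<x \text{ or } z<x\}$ and $-\mathrm{R}_{\min}=\{(-x,-y,-z):(x,y,z)\in\mathrm{R}_{\min}\}=\{(x,y,z): x<y \text{ or } x<z\}$. An operation $f:\mathbb{Q}^n\to\mathbb{Q}$ preserves a relation $R$ if applying $f$ componentwise to any $n$ tuples of $R$ yields a tuple of $R$; $\mathfrak{B}$ is preserved by $f$ if all its relations are. A binary operation preserves $\le$ if $a\le a'$ and $b\le b'$ imply $f(a,b)\le f(a',b')$. *)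

theory Defs
  imports Complex_Main
begin

section \<open>Relational structures\<close>

text \<open>
  The domain of a structure is the whole type \<open>'a\<close>; \<open>'r\<close> is the type from which relation
  symbols are drawn, and \<open>symbols\<close> is the signature. A \<open>k\<close>-tuple is a list of length \<open>k\<close>.
\<close>

record ('r, 'a) relstruct =
  symbols :: "'r set"
  arity :: "'r \<Rightarrow> nat"
  interp :: "'r \<Rightarrow> 'a list set"

definition relational_structure :: "('r, 'a) relstruct \<Rightarrow> bool" where
  "relational_structure B \<longleftrightarrow>
     (\<forall>r\<in>symbols B. \<forall>t\<in>interp B r. length t = arity B r)"


section \<open>First-order and primitive positive definability\<close>

datatype 'r fo =
    Rel 'r "nat list"
  | Eq nat nat
  | Neg "'r fo"
  | Conj "'r fo list"
  | Ex nat "'r fo"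

fun sat :: "('r, 'a) relstruct \<Rightarrow> (nat \<Rightarrow> 'a) \<Rightarrow> 'r fo \<Rightarrow> bool" where
  "sat B \<sigma> (Rel r xs) \<longleftrightarrow> map \<sigma> xs \<in> interp B r"
| "sat B \<sigma> (Eq x y) \<longleftrightarrow> \<sigma> x = \<sigma> y"
| "sat B \<sigma> (Neg \<phi>) \<longleftrightarrow> \<not> sat B \<sigma> \<phi>"
| "sat B \<sigma> (Conj \<phi>s) \<longleftrightarrow> (\<forall>\<phi>\<in>set \<phi>s. sat B \<sigma> \<phi>)"
| "sat B \<sigma> (Ex x \<phi>) \<longleftrightarrow> (\<exists>a. sat B (\<sigma>(x := a)) \<phi>)"

fun free_vars :: "'r fo \<Rightarrow> nat set" where
  "free_vars (Rel r xs) = set xs"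
| "free_vars (Eq x y) = {x, y}"
| "free_vars (Neg \<phi>) = free_vars \<phi>"
| "free_vars (Conj \<phi>s) = (\<Union>\<phi>\<in>set \<phi>s. free_vars \<phi>)"
| "free_vars (Ex x \<phi>) = free_vars \<phi> - {x}"

fun wf_fo :: "('r, 'a) relstruct \<Rightarrow> 'r fo \<Rightarrow> bool" where
  "wf_fo B (Rel r xs) \<longleftrightarrow> r \<in> symbols B \<and> length xs = arity B r"
| "wf_fo B (Eq x y) \<longleftrightarrow> True"
| "wf_fo B (Neg \<phi>) \<longleftrightarrow> wf_fo B \<phi>"
| "wf_fo B (Conj \<phi>s) \<longleftrightarrow> (\<forall>\<phi>\<in>set \<phi>s. wf_fo B \<phi>)"
| "wf_fo B (Ex x \<phi>) \<longleftrightarrow> wf_fo B \<phi>"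

text \<open>
  The formula \<open>\<phi>\<close>, with free variables among \<open>0, \<dots>, k - 1\<close>, defines the \<open>k\<close>-ary relation
  \<open>R\<close>. Entries \<open>t ! i\<close> with \<open>i \<ge> k\<close> are never consulted because of the free variable condition.
\<close>

definition defines_rel ::
  "('r, 'a) relstruct \<Rightarrow> 'r fo \<Rightarrow> nat \<Rightarrow> 'a list set \<Rightarrow> bool" where
  "defines_rel B \<phi> k R \<longleftrightarrow>
     wf_fo B \<phi> \<and> free_vars \<phi> \<subseteq> {..<k} \<and>
     R = {t. length t = k \<and> sat B (\<lambda>i. t ! i) \<phi>}"

definition fo_definable :: "('r, 'a) relstruct \<Rightarrow> nat \<Rightarrow> 'a list set \<Rightarrow> bool" where
  "fo_definable B k R \<longleftrightarrow> (\<exists>\<phi>. defines_rel B \<phi> k R)"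

fun atomic :: "'r fo \<Rightarrow> bool" where
  "atomic (Rel r xs) \<longleftrightarrow> True"
| "atomic (Eq x y) \<longleftrightarrow> True"
| "atomic _ \<longleftrightarrow> False"

definition primitive_positive :: "'r fo \<Rightarrow> bool" where
  "primitive_positive \<phi> \<longleftrightarrow>
     (\<exists>xs \<phi>s. (\<forall>\<psi>\<in>set \<phi>s. atomic \<psi>) \<and> \<phi> = foldr Ex xs (Conj \<phi>s))"

definition pp_definable :: "('r, 'a) relstruct \<Rightarrow> nat \<Rightarrow> 'a list set \<Rightarrow> bool" where
  "pp_definable B k R \<longleftrightarrow> (\<exists>\<phi>. primitive_positive \<phi> \<and> defines_rel B \<phi> k R)"


section \<open>Temporal structures\<close>

definition less_rel :: "rat list set" where
  "less_rel = {[x, y] | x y. x < y}"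

definition rat_order :: "(unit, rat) relstruct" where
  "rat_order = \<lparr>symbols = UNIV, arity = (\<lambda>_. 2), interp = (\<lambda>_. less_rel)\<rparr>"

definition temporal_structure :: "('r, rat) relstruct \<Rightarrow> bool" where
  "temporal_structure B \<longleftrightarrow>
     relational_structure B \<and> finite (symbols B) \<and>
     (\<forall>r\<in>symbols B. fo_definable rat_order (arity B r) (interp B r))"

definition R_min :: "rat list set" where
  "R_min = {[x, y, z] | x y z. y < x \<or> z < x}"

definition neg_rel :: "rat list set \<Rightarrow> rat list set" where
  "neg_rel R = map uminus ` R"


section \<open>Preservation by binary operations\<close>

definition preserves_rel :: "('a \<Rightarrow> 'a \<Rightarrow> 'a) \<Rightarrow> 'a list set \<Rightarrow> bool" where
  "preserves_rel f R \<longleftrightarrow> (\<forall>s\<in>R. \<forall>t\<in>R. map2 f s t \<in> R)"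

definition preserved_by :: "('r, 'a) relstruct \<Rightarrow> ('a \<Rightarrow> 'a \<Rightarrow> 'a) \<Rightarrow> bool" where
  "preserved_by B f \<longleftrightarrow> (\<forall>r\<in>symbols B. preserves_rel f (interp B r))"

definition preserves_le :: "('a::ord \<Rightarrow> 'a \<Rightarrow> 'a) \<Rightarrow> bool" where
  "preserves_le f \<longleftrightarrow> (\<forall>a a' b b'. a \<le> a' \<longrightarrow> b \<le> b' \<longrightarrow> f a b \<le> f a' b')"

definition injective2 :: "('a \<Rightarrow> 'a \<Rightarrow> 'a) \<Rightarrow> bool" where
  "injective2 f \<longleftrightarrow> inj (\<lambda>(a, b). f a b)"

end

theory Submission
  imports Defs "HOL-Library.Countable"
begin

text \<open>
  Suppose \<open>s, t \<in> R\<close> but \<open>u = f s t \<notin> R\<close> for an injective \<open>f\<close> preserving \<open>\<le>\<close>. Impose on \<open>R\<close> all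
  equalities between coordinates that hold in \<open>u\<close>. The constraints \<open>x\<^sub>i < x\<^sub>j\<close> for \<open>u\<^sub>i < u\<^sub>j\<close> are
  jointly unsatisfiable, since they determine the order type of \<open>u\<close>, but each is satisfied by \<open>s\<close>
  or by \<open>t\<close>. Take an unsatisfiable set of them of least cardinality, and move all but two of its
  members, \<open>x\<^sub>a < x\<^sub>b\<close> and \<open>x\<^sub>c < x\<^sub>d\<close>, into the relation. The two exclude each other, while by
  minimality every single constraint remains satisfiable. If \<open>u\<^sub>a \<le> u\<^sub>c\<close>, then \<open>x\<^sub>a < x\<^sub>d\<close> is one of
  the constraints. If it is incompatible with \<open>x\<^sub>a < x\<^sub>b\<close> or with \<open>x\<^sub>c < x\<^sub>d\<close>, then two constraints
  with a common left or right end exclude each other, which gives \<open>R_min\<close> or its dual. Otherwise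
  two copies of the relation can be coupled to define \<open>R_min\<close>.

  Conversely, an embedding of \<open>\<rat> \<times> \<rat>\<close> ordered by the sum of the components, with ties broken
  by the first one, violates \<open>R_min\<close> and its dual.
\<close>

section \<open>Primitive positive predicates on assignments\<close>

lemma sat_cong:
  "(\<And>i. i \<in> free_vars \<phi> \<Longrightarrow> \<sigma> i = \<tau> i) \<Longrightarrow> sat B \<sigma> \<phi> \<longleftrightarrow> sat B \<tau> \<phi>"
proof (induction \<phi> arbitrary: \<sigma> \<tau>)
  case (Rel r xs)
  then have "map \<sigma> xs = map \<tau> xs" by simp
  then show ?case by (simp only: sat.simps)
next
  case (Eq x y)
  then have "\<sigma> x = \<tau> x" "\<sigma> y = \<tau> y" by simp_all
  then show ?case by simp
next
  case (Neg \<phi>)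
  have "sat B \<sigma> \<phi> \<longleftrightarrow> sat B \<tau> \<phi>"
    by (rule Neg.IH) (use Neg.prems in simp)
  then show ?case by simp
next
  case (Conj \<phi>s)
  have "sat B \<sigma> \<phi> \<longleftrightarrow> sat B \<tau> \<phi>" if "\<phi> \<in> set \<phi>s" for \<phi>
    by (rule Conj.IH[OF that]) (use that Conj.prems in auto)
  then show ?case by simp
next
  case (Ex x \<phi>)
  have "sat B (\<sigma>(x := a)) \<phi> \<longleftrightarrow> sat B (\<tau>(x := a)) \<phi>" for a
    by (rule Ex.IH) (use Ex.prems in simp)
  then show ?case by simp
qed

text \<open>A block of quantifiers amounts to one simultaneous choice of values on
  \<open>set xs\<close>, so order and repetitions in \<open>xs\<close> do not matter.\<close>

lemma sat_foldr_Ex: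
  "sat B \<sigma> (foldr Ex xs \<phi>) \<longleftrightarrow> (\<exists>\<tau>. (\<forall>i. i \<notin> set xs \<longrightarrow> \<tau> i = \<sigma> i) \<and> sat B \<tau> \<phi>)"
proof (induction xs arbitrary: \<sigma>)
  case Nil
  have "\<tau> = \<sigma>" if "\<forall>i. \<tau> i = \<sigma> i" for \<tau>
    using that by auto
  then show ?case by auto
next
  case (Cons x xs)
  show ?case (is "?L \<longleftrightarrow> ?R")
  proof
    assume ?L
    then obtain a \<tau> where \<tau>: "\<forall>i. i \<notin> set xs \<longrightarrow> \<tau> i = (\<sigma>(x := a)) i" "sat B \<tau> \<phi>"
      by (auto simp only: foldr_Cons o_apply sat.simps Cons.IH)
    then have "\<forall>i. i \<notin> set (x # xs) \<longrightarrow> \<tau> i = \<sigma> i" by simp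
    with \<tau>(2) show ?R by blast
  next
    assume ?R
    then obtain \<tau> where \<tau>: "\<forall>i. i \<notin> set (x # xs) \<longrightarrow> \<tau> i = \<sigma> i" "sat B \<tau> \<phi>" by blast
    then have "\<forall>i. i \<notin> set xs \<longrightarrow> \<tau> i = (\<sigma>(x := \<tau> x)) i" by simp
    with \<tau>(2) have "sat B (\<sigma>(x := \<tau> x)) (foldr Ex xs \<phi>)"
      unfolding Cons.IH by blast
    then show ?L by auto
  qed
qed

lemma free_vars_foldr_Ex [simp]: "free_vars (foldr Ex xs \<phi>) = free_vars \<phi> - set xs"
  by (induction xs) auto

lemma wf_fo_foldr_Ex [simp]: "wf_fo B (foldr Ex xs \<phi>) \<longleftrightarrow> wf_fo B \<phi>"
  by (induction xs) auto

lemma finite_free_vars: "finite (free_vars \<phi>)"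
  by (induction \<phi>) auto

text \<open>Meant for atoms, where no variable can be captured; the last clause is a mere
  default.\<close>

fun rename_vars :: "(nat \<Rightarrow> nat) \<Rightarrow> 'r fo \<Rightarrow> 'r fo" where
  "rename_vars \<rho> (Rel r xs) = Rel r (map \<rho> xs)"
| "rename_vars \<rho> (Eq x y) = Eq (\<rho> x) (\<rho> y)"
| "rename_vars \<rho> \<phi> = \<phi>"

lemma rename_vars_atomic:
  assumes "atomic \<phi>"
  shows "atomic (rename_vars \<rho> \<phi>)" "wf_fo B (rename_vars \<rho> \<phi>) \<longleftrightarrow> wf_fo B \<phi>"
    "sat B \<tau> (rename_vars \<rho> \<phi>) \<longleftrightarrow> sat B (\<tau> \<circ> \<rho>) \<phi>"
  using assms by (cases \<phi>; simp; fail)+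

lemma sat_map_rename_vars:
  assumes "\<And>\<phi>. \<phi> \<in> set \<Phi> \<Longrightarrow> atomic \<phi>"
  shows "(\<forall>\<phi>\<in>set (map (rename_vars \<rho>) \<Phi>). sat B \<tau> \<phi>) \<longleftrightarrow> (\<forall>\<phi>\<in>set \<Phi>. sat B (\<tau> \<circ> \<rho>) \<phi>)"
  using assms by (simp add: rename_vars_atomic)

text \<open>A semantic form of pp definability in which the variables \<open>0, \<dots>, k - 1\<close> are free and all
  others are implicitly existentially quantified.\<close>

definition pp_pred :: "('r, 'a) relstruct \<Rightarrow> nat \<Rightarrow> ((nat \<Rightarrow> 'a) \<Rightarrow> bool) \<Rightarrow> bool" where
  "pp_pred B k P \<longleftrightarrow> (\<exists>\<Phi>. (\<forall>\<phi>\<in>set \<Phi>. atomic \<phi> \<and> wf_fo B \<phi>) \<and>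
     (\<forall>\<sigma>. P \<sigma> \<longleftrightarrow> (\<exists>\<tau>. (\<forall>i<k. \<tau> i = \<sigma> i) \<and> (\<forall>\<phi>\<in>set \<Phi>. sat B \<tau> \<phi>))))"

lemma pp_predE:
  assumes "pp_pred B k P"
  obtains \<Phi> where "\<And>\<phi>. \<phi> \<in> set \<Phi> \<Longrightarrow> atomic \<phi>" "\<And>\<phi>. \<phi> \<in> set \<Phi> \<Longrightarrow> wf_fo B \<phi>"
    "\<And>\<sigma>. P \<sigma> \<longleftrightarrow> (\<exists>\<tau>. (\<forall>i<k. \<tau> i = \<sigma> i) \<and> (\<forall>\<phi>\<in>set \<Phi>. sat B \<tau> \<phi>))"
  using assms unfolding pp_pred_def by blast

lemma pp_pred_cong:
  assumes "pp_pred B k P" "\<And>i. i < k \<Longrightarrow> \<sigma> i = \<tau> i"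
  shows "P \<sigma> \<longleftrightarrow> P \<tau>"
proof -
  obtain \<Phi> where "\<And>\<sigma>. P \<sigma> \<longleftrightarrow> (\<exists>\<tau>. (\<forall>i<k. \<tau> i = \<sigma> i) \<and> (\<forall>\<phi>\<in>set \<Phi>. sat B \<tau> \<phi>))"
    using assms(1) unfolding pp_pred_def by blast
  with assms(2) show ?thesis by simp
qed

lemma pp_pred_atom:
  assumes "atomic \<phi>" "wf_fo B \<phi>" "free_vars \<phi> \<subseteq> {..<k}"
  shows "pp_pred B k (\<lambda>\<sigma>. sat B \<sigma> \<phi>)"
proof -
  have "sat B \<tau> \<phi> \<longleftrightarrow> sat B \<sigma> \<phi>" if "\<forall>i<k. \<tau> i = \<sigma> i" for \<sigma> \<tau>
    using that assms(3) by (intro sat_cong) auto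
  then have "sat B \<sigma> \<phi> \<longleftrightarrow> (\<exists>\<tau>. (\<forall>i<k. \<tau> i = \<sigma> i) \<and> (\<forall>\<psi>\<in>set [\<phi>]. sat B \<tau> \<psi>))" for \<sigma>
    by (simp, blast)
  moreover have "\<forall>\<psi>\<in>set [\<phi>]. atomic \<psi> \<and> wf_fo B \<psi>"
    using assms(1,2) by simp
  ultimately show ?thesis
    unfolding pp_pred_def by blast
qed

section \<open>Closure of pp predicates under conjunction, substitution and projection\<close>

lemma pp_pred_True: "pp_pred B k (\<lambda>_. True)"
  unfolding pp_pred_def by (intro exI[of _ "[]"]) auto

lemma pp_pred_conj:
  assumes "pp_pred B k P" "pp_pred B k Q"
  shows "pp_pred B k (\<lambda>\<sigma>. P \<sigma> \<and> Q \<sigma>)"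
proof -
  obtain \<Phi> where \<Phi>: "\<And>\<phi>. \<phi> \<in> set \<Phi> \<Longrightarrow> atomic \<phi>" "\<And>\<phi>. \<phi> \<in> set \<Phi> \<Longrightarrow> wf_fo B \<phi>"
    "\<And>\<sigma>. P \<sigma> \<longleftrightarrow> (\<exists>\<tau>. (\<forall>i<k. \<tau> i = \<sigma> i) \<and> (\<forall>\<phi>\<in>set \<Phi>. sat B \<tau> \<phi>))"
    using assms(1) by (rule pp_predE) blast
  obtain \<Psi> where \<Psi>: "\<And>\<phi>. \<phi> \<in> set \<Psi> \<Longrightarrow> atomic \<phi>" "\<And>\<phi>. \<phi> \<in> set \<Psi> \<Longrightarrow> wf_fo B \<phi>"
    "\<And>\<sigma>. Q \<sigma> \<longleftrightarrow> (\<exists>\<tau>. (\<forall>i<k. \<tau> i = \<sigma> i) \<and> (\<forall>\<phi>\<in>set \<Psi>. sat B \<tau> \<phi>))"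
    using assms(2) by (rule pp_predE) blast
  \<comment> \<open>From \<open>k\<close> onwards, the auxiliary variables of \<open>\<Phi>\<close>
    move to even indices and those of \<open>\<Psi>\<close> to odd ones. The images stay at or above
    \<open>k\<close>, so the two witnesses coexist over the shared free variables.\<close>
  define \<alpha> where "\<alpha> = (\<lambda>i. if i < k then i else 2 * i)"
  define \<beta> where "\<beta> = (\<lambda>i. if i < k then i else 2 * i + 1)"
  define \<Theta> where "\<Theta> = map (rename_vars \<alpha>) \<Phi> @ map (rename_vars \<beta>) \<Psi>"
  have sat: "(\<forall>\<phi>\<in>set \<Theta>. sat B \<tau> \<phi>) \<longleftrightarrow>
      (\<forall>\<phi>\<in>set \<Phi>. sat B (\<tau> \<circ> \<alpha>) \<phi>) \<and> (\<forall>\<phi>\<in>set \<Psi>. sat B (\<tau> \<circ> \<beta>) \<phi>)" for \<tau>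
    unfolding \<Theta>_def set_append ball_Un
    using sat_map_rename_vars[OF \<Phi>(1)] sat_map_rename_vars[OF \<Psi>(1)] by blast
  have "P \<sigma> \<and> Q \<sigma> \<longleftrightarrow> (\<exists>\<tau>. (\<forall>i<k. \<tau> i = \<sigma> i) \<and> (\<forall>\<phi>\<in>set \<Theta>. sat B \<tau> \<phi>))" for \<sigma>
  proof
    assume "P \<sigma> \<and> Q \<sigma>"
    then obtain \<tau>1 \<tau>2 where \<tau>: "\<forall>i<k. \<tau>1 i = \<sigma> i" "\<forall>\<phi>\<in>set \<Phi>. sat B \<tau>1 \<phi>"
      "\<forall>i<k. \<tau>2 i = \<sigma> i" "\<forall>\<phi>\<in>set \<Psi>. sat B \<tau>2 \<phi>"
      using \<Phi>(3) \<Psi>(3) by blast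
    define \<tau> where "\<tau> = (\<lambda>i. if i < k then \<sigma> i else if even i then \<tau>1 (i div 2) else \<tau>2 (i div 2))"
    have "\<tau> \<circ> \<alpha> = \<tau>1" "\<tau> \<circ> \<beta> = \<tau>2"
      using \<tau>(1,3) by (auto simp: fun_eq_iff \<tau>_def \<alpha>_def \<beta>_def)
    with \<tau> have "(\<forall>i<k. \<tau> i = \<sigma> i) \<and> (\<forall>\<phi>\<in>set \<Theta>. sat B \<tau> \<phi>)"
      unfolding sat by (simp add: \<tau>_def)
    then show "\<exists>\<tau>. (\<forall>i<k. \<tau> i = \<sigma> i) \<and> (\<forall>\<phi>\<in>set \<Theta>. sat B \<tau> \<phi>)" by blast
  next
    assume "\<exists>\<tau>. (\<forall>i<k. \<tau> i = \<sigma> i) \<and> (\<forall>\<phi>\<in>set \<Theta>. sat B \<tau> \<phi>)"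
    then obtain \<tau> where \<tau>: "\<forall>i<k. \<tau> i = \<sigma> i" "\<forall>\<phi>\<in>set \<Theta>. sat B \<tau> \<phi>" by blast
    then have "\<forall>i<k. (\<tau> \<circ> \<alpha>) i = \<sigma> i" "\<forall>i<k. (\<tau> \<circ> \<beta>) i = \<sigma> i"
      by (simp_all add: \<alpha>_def \<beta>_def)
    with \<tau>(2) show "P \<sigma> \<and> Q \<sigma>"
      unfolding sat \<Phi>(3) \<Psi>(3) by blast
  qed
  moreover have "\<forall>\<phi>\<in>set \<Theta>. atomic \<phi> \<and> wf_fo B \<phi>"
    using \<Phi>(1,2) \<Psi>(1,2) by (auto simp: \<Theta>_def rename_vars_atomic)
  ultimately show ?thesis
    unfolding pp_pred_def by blast
qed

lemma pp_pred_Ball: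
  assumes "finite A" "\<And>x. x \<in> A \<Longrightarrow> pp_pred B k (P x)"
  shows "pp_pred B k (\<lambda>\<sigma>. \<forall>x\<in>A. P x \<sigma>)"
  using assms
proof (induction A)
  case empty
  then show ?case by (simp add: pp_pred_True)
next
  case (insert x A)
  then show ?case by (simp add: pp_pred_conj)
qed

lemma pp_pred_rename:
  assumes "pp_pred B m P" "\<And>i. i < m \<Longrightarrow> \<rho> i < k"
  shows "pp_pred B k (\<lambda>\<sigma>. P (\<lambda>i. \<sigma> (\<rho> i)))"
proof -
  obtain \<Phi> where \<Phi>: "\<And>\<phi>. \<phi> \<in> set \<Phi> \<Longrightarrow> atomic \<phi>" "\<And>\<phi>. \<phi> \<in> set \<Phi> \<Longrightarrow> wf_fo B \<phi>"
    "\<And>\<sigma>. P \<sigma> \<longleftrightarrow> (\<exists>\<tau>. (\<forall>i<m. \<tau> i = \<sigma> i) \<and> (\<forall>\<phi>\<in>set \<Phi>. sat B \<tau> \<phi>))"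
    using assms(1) by (rule pp_predE) blast
  \<comment> \<open>The auxiliary variables move to \<open>k + i\<close>, clear of all free indices;
    \<open>\<rho>\<close> itself may identify variables.\<close>
  define \<alpha> where "\<alpha> = (\<lambda>i. if i < m then \<rho> i else k + i)"
  have "P (\<lambda>i. \<sigma> (\<rho> i)) \<longleftrightarrow>
      (\<exists>\<tau>. (\<forall>i<k. \<tau> i = \<sigma> i) \<and> (\<forall>\<phi>\<in>set (map (rename_vars \<alpha>) \<Phi>). sat B \<tau> \<phi>))" (is "?L \<longleftrightarrow> ?R") for \<sigma>
  proof
    assume ?L
    then obtain \<tau>1 where \<tau>: "\<forall>i<m. \<tau>1 i = \<sigma> (\<rho> i)" "\<forall>\<phi>\<in>set \<Phi>. sat B \<tau>1 \<phi>"
      unfolding \<Phi>(3) by blast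
    define \<tau> where "\<tau> = (\<lambda>i. if i < k then \<sigma> i else \<tau>1 (i - k))"
    have "\<tau> \<circ> \<alpha> = \<tau>1"
      using \<tau>(1) assms(2) by (auto simp: fun_eq_iff \<tau>_def \<alpha>_def)
    with \<tau>(2) \<Phi>(1) have "(\<forall>i<k. \<tau> i = \<sigma> i) \<and> (\<forall>\<phi>\<in>set (map (rename_vars \<alpha>) \<Phi>). sat B \<tau> \<phi>)"
      by (simp add: sat_map_rename_vars \<tau>_def del: set_map)
    then show ?R by blast
  next
    assume ?R
    then obtain \<tau> where \<tau>: "\<forall>i<k. \<tau> i = \<sigma> i" "\<forall>\<phi>\<in>set (map (rename_vars \<alpha>) \<Phi>). sat B \<tau> \<phi>" by blast
    then have "(\<forall>i<m. (\<tau> \<circ> \<alpha>) i = \<sigma> (\<rho> i)) \<and> (\<forall>\<phi>\<in>set \<Phi>. sat B (\<tau> \<circ> \<alpha>) \<phi>)"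
      using assms(2) \<Phi>(1) by (simp add: sat_map_rename_vars \<alpha>_def del: set_map)
    then show ?L
      unfolding \<Phi>(3) by blast
  qed
  moreover have "\<forall>\<phi>\<in>set (map (rename_vars \<alpha>) \<Phi>). atomic \<phi> \<and> wf_fo B \<phi>"
    using \<Phi>(1,2) by (auto simp: rename_vars_atomic)
  ultimately show ?thesis
    unfolding pp_pred_def by blast
qed

text \<open>The same atoms serve: lowering the bound turns the variables from \<open>k\<close> to
  \<open>n - 1\<close> into existential ones.\<close>

lemma pp_pred_project:
  assumes "pp_pred B n P" "k \<le> n"
  shows "pp_pred B k (\<lambda>\<sigma>. \<exists>\<tau>. (\<forall>i<k. \<tau> i = \<sigma> i) \<and> P \<tau>)"
proof -
  obtain \<Phi> where \<Phi>: "\<And>\<phi>. \<phi> \<in> set \<Phi> \<Longrightarrow> atomic \<phi>" "\<And>\<phi>. \<phi> \<in> set \<Phi> \<Longrightarrow> wf_fo B \<phi>"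
    "\<And>\<sigma>. P \<sigma> \<longleftrightarrow> (\<exists>\<tau>. (\<forall>i<n. \<tau> i = \<sigma> i) \<and> (\<forall>\<phi>\<in>set \<Phi>. sat B \<tau> \<phi>))"
    using assms(1) by (rule pp_predE) blast
  have "(\<exists>\<tau>. (\<forall>i<k. \<tau> i = \<sigma> i) \<and> P \<tau>) \<longleftrightarrow>
      (\<exists>\<tau>. (\<forall>i<k. \<tau> i = \<sigma> i) \<and> (\<forall>\<phi>\<in>set \<Phi>. sat B \<tau> \<phi>))"
    (is "?L \<longleftrightarrow> ?R") for \<sigma>
  proof
    assume ?L
    then obtain \<tau> \<tau>' where "\<forall>i<k. \<tau> i = \<sigma> i" "\<forall>i<n. \<tau>' i = \<tau> i" "\<forall>\<phi>\<in>set \<Phi>. sat B \<tau>' \<phi>"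
      unfolding \<Phi>(3) by blast
    moreover from this(1,2) have "\<forall>i<k. \<tau>' i = \<sigma> i"
      using assms(2) by simp
    ultimately show ?R by blast
  next
    assume ?R
    then show ?L unfolding \<Phi>(3) by blast
  qed
  with \<Phi>(1,2) show ?thesis
    unfolding pp_pred_def by blast
qed

section \<open>Translation between pp formulas and pp predicates\<close>

lemma pp_definableI:
  assumes "pp_pred B k P" "R = {t. length t = k \<and> P (\<lambda>i. t ! i)}"
  shows "pp_definable B k R"
proof -
  obtain \<Phi> where \<Phi>: "\<And>\<phi>. \<phi> \<in> set \<Phi> \<Longrightarrow> atomic \<phi>" "\<And>\<phi>. \<phi> \<in> set \<Phi> \<Longrightarrow> wf_fo B \<phi>"
    "\<And>\<sigma>. P \<sigma> \<longleftrightarrow> (\<exists>\<tau>. (\<forall>i<k. \<tau> i = \<sigma> i) \<and> (\<forall>\<phi>\<in>set \<Phi>. sat B \<tau> \<phi>))"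
    using assms(1) by (rule pp_predE) blast
  \<comment> \<open>A formula has finitely many quantifiers; those for the variables occurring in
    \<open>\<Phi>\<close> suffice.\<close>
  define V where "V = free_vars (Conj \<Phi>) - {..<k}"
  have "finite V"
    using finite_free_vars V_def by blast
  then obtain xs where xs: "set xs = V"
    using finite_list by blast
  define \<phi> where "\<phi> = foldr Ex xs (Conj \<Phi>)"
  have "sat B \<sigma> \<phi> \<longleftrightarrow> P \<sigma>" for \<sigma>
  proof
    assume "sat B \<sigma> \<phi>"
    then show "P \<sigma>"
      unfolding \<phi>_def sat_foldr_Ex xs \<Phi>(3) by (auto simp: V_def)
  next
    assume "P \<sigma>"
    then obtain \<tau> where \<tau>: "\<forall>i<k. \<tau> i = \<sigma> i" "sat B \<tau> (Conj \<Phi>)"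
      unfolding \<Phi>(3) by auto
    \<comment> \<open>The witness has to return to \<open>\<sigma>\<close> off \<open>V\<close>. An
      occurring variable outside \<open>V\<close> has index below \<open>k\<close>, where
      \<open>\<tau>\<close> and \<open>\<sigma>\<close> agree.\<close>
    define \<tau>' where "\<tau>' = (\<lambda>i. if i \<in> V then \<tau> i else \<sigma> i)"
    have "sat B \<tau>' (Conj \<Phi>) \<longleftrightarrow> sat B \<tau> (Conj \<Phi>)"
    proof (rule sat_cong)
      fix i assume "i \<in> free_vars (Conj \<Phi>)"
      then show "\<tau>' i = \<tau> i"
        using \<tau>(1) unfolding \<tau>'_def V_def by (cases "i < k") auto
    qed
    moreover have "\<forall>i. i \<notin> V \<longrightarrow> \<tau>' i = \<sigma> i"
      by (simp add: \<tau>'_def)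
    ultimately show "sat B \<sigma> \<phi>"
      using \<tau>(2) unfolding \<phi>_def sat_foldr_Ex xs by blast
  qed
  then have "defines_rel B \<phi> k R"
    using \<Phi>(2) assms(2) xs by (auto simp: defines_rel_def \<phi>_def V_def)
  moreover have "primitive_positive \<phi>"
    using \<Phi>(1) unfolding primitive_positive_def \<phi>_def by blast
  ultimately show ?thesis
    unfolding pp_definable_def by blast
qed

lemma pp_definableD:
  assumes "pp_definable B k R"
  shows "pp_pred B k (\<lambda>\<sigma>. map \<sigma> [0..<k] \<in> R)"
proof -
  obtain xs \<Phi> where at: "\<forall>\<psi>\<in>set \<Phi>. atomic \<psi>" and "defines_rel B (foldr Ex xs (Conj \<Phi>)) k R"
    using assms unfolding pp_definable_def primitive_positive_def by blast
  then have wf: "\<forall>\<psi>\<in>set \<Phi>. wf_fo B \<psi>" and fv: "free_vars (Conj \<Phi>) - set xs \<subseteq> {..<k}"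
    and R: "R = {t. length t = k \<and> sat B (\<lambda>i. t ! i) (foldr Ex xs (Conj \<Phi>))}"
    unfolding defines_rel_def by auto
  \<comment> \<open>Quantified variables may have indices below \<open>k\<close>; the shift
    separates them from the free ones.\<close>
  define \<rho> where "\<rho> = (\<lambda>i. if i \<in> set xs then k + i else i)"
  have "map \<sigma> [0..<k] \<in> R \<longleftrightarrow>
      (\<exists>\<tau>. (\<forall>i<k. \<tau> i = \<sigma> i) \<and> (\<forall>\<phi>\<in>set (map (rename_vars \<rho>) \<Phi>). sat B \<tau> \<phi>))" (is "_ \<longleftrightarrow> ?R") for \<sigma>
  proof -
    have "map \<sigma> [0..<k] \<in> R \<longleftrightarrow> sat B \<sigma> (foldr Ex xs (Conj \<Phi>))"
    proof -
      have "sat B (\<lambda>i. map \<sigma> [0..<k] ! i) (foldr Ex xs (Conj \<Phi>)) \<longleftrightarrow> sat B \<sigma> (foldr Ex xs (Conj \<Phi>))"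
        using fv by (intro sat_cong) (auto simp del: free_vars.simps)
      then show ?thesis by (simp add: R)
    qed
    also have "\<dots> \<longleftrightarrow> ?R"
    proof
      assume "sat B \<sigma> (foldr Ex xs (Conj \<Phi>))"
      then obtain \<tau>1 where \<tau>1: "\<forall>i. i \<notin> set xs \<longrightarrow> \<tau>1 i = \<sigma> i" "sat B \<tau>1 (Conj \<Phi>)"
        unfolding sat_foldr_Ex by blast
      define \<tau> where "\<tau> = (\<lambda>i. if i < k then \<sigma> i else \<tau>1 (i - k))"
      have "sat B (\<tau> \<circ> \<rho>) (Conj \<Phi>) \<longleftrightarrow> sat B \<tau>1 (Conj \<Phi>)"
        using fv \<tau>1(1) by (intro sat_cong) (auto simp: \<tau>_def \<rho>_def)
      with \<tau>1(2) at have "(\<forall>i<k. \<tau> i = \<sigma> i) \<and> (\<forall>\<phi>\<in>set (map (rename_vars \<rho>) \<Phi>). sat B \<tau> \<phi>)"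
        by (simp add: sat_map_rename_vars \<tau>_def del: set_map)
      then show ?R by blast
    next
      assume ?R
      then obtain \<tau> where \<tau>: "\<forall>i<k. \<tau> i = \<sigma> i" "sat B (\<tau> \<circ> \<rho>) (Conj \<Phi>)"
        using at by (auto simp: sat_map_rename_vars simp del: set_map)
      define \<tau>' where "\<tau>' = (\<lambda>i. if i \<in> set xs then \<tau> (k + i) else \<sigma> i)"
      have "sat B \<tau>' (Conj \<Phi>) \<longleftrightarrow> sat B (\<tau> \<circ> \<rho>) (Conj \<Phi>)"
        using fv \<tau>(1) by (intro sat_cong) (auto simp: \<tau>'_def \<rho>_def)
      then have "(\<forall>i. i \<notin> set xs \<longrightarrow> \<tau>' i = \<sigma> i) \<and> sat B \<tau>' (Conj \<Phi>)"
        using \<tau>(2) by (simp add: \<tau>'_def)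
      then show "sat B \<sigma> (foldr Ex xs (Conj \<Phi>))"
        unfolding sat_foldr_Ex by blast
    qed
    finally show ?thesis .
  qed
  moreover have "\<forall>\<phi>\<in>set (map (rename_vars \<rho>) \<Phi>). atomic \<phi> \<and> wf_fo B \<phi>"
    using at wf by (auto simp: rename_vars_atomic)
  ultimately show ?thesis
    unfolding pp_pred_def by blast
qed

text \<open>Polymorphisms preserve pp definable relations: \<open>f\<close> is applied to the full
  witnesses, auxiliary variables included, and every atom survives.\<close>

lemma pp_pred_preserved:
  assumes "pp_pred B k P" "preserved_by B f" "P \<sigma>" "P \<tau>"
  shows "P (\<lambda>i. f (\<sigma> i) (\<tau> i))"
proof -
  obtain \<Phi> where \<Phi>: "\<And>\<phi>. \<phi> \<in> set \<Phi> \<Longrightarrow> atomic \<phi>" "\<And>\<phi>. \<phi> \<in> set \<Phi> \<Longrightarrow> wf_fo B \<phi>"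
    "\<And>\<sigma>. P \<sigma> \<longleftrightarrow> (\<exists>\<tau>. (\<forall>i<k. \<tau> i = \<sigma> i) \<and> (\<forall>\<phi>\<in>set \<Phi>. sat B \<tau> \<phi>))"
    using assms(1) by (rule pp_predE) blast
  obtain \<sigma>' \<tau>' where *: "\<forall>i<k. \<sigma>' i = \<sigma> i" "\<forall>i<k. \<tau>' i = \<tau> i"
    "\<forall>\<phi>\<in>set \<Phi>. sat B \<sigma>' \<phi>" "\<forall>\<phi>\<in>set \<Phi>. sat B \<tau>' \<phi>"
    using assms(3,4) unfolding \<Phi>(3) by blast
  have "sat B (\<lambda>i. f (\<sigma>' i) (\<tau>' i)) \<phi>" if "\<phi> \<in> set \<Phi>" for \<phi>
  proof (cases \<phi>)
    case (Rel r xs)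
    have "map2 f (map \<sigma>' xs) (map \<tau>' xs) = map (\<lambda>i. f (\<sigma>' i) (\<tau>' i)) xs"
      by (induction xs) auto
    moreover have "preserves_rel f (interp B r)"
      using assms(2) \<Phi>(2)[OF that] Rel by (simp add: preserved_by_def)
    moreover have "map \<sigma>' xs \<in> interp B r" "map \<tau>' xs \<in> interp B r"
      using *(3,4) that Rel by force+
    ultimately show ?thesis
      unfolding preserves_rel_def Rel by fastforce
  next
    case (Eq x y)
    then show ?thesis using *(3,4) that by force
  qed (use \<Phi>(1)[OF that] in simp_all)
  then show ?thesis
    unfolding \<Phi>(3) using *(1,2)
    by (intro exI[of _ "\<lambda>i. f (\<sigma>' i) (\<tau>' i)"]) simp
qed

lemma pp_pred_interp:
  assumes "r \<in> symbols B" "arity B r = k"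
  shows "pp_pred B k (\<lambda>\<sigma>. map \<sigma> [0..<k] \<in> interp B r)"
  using pp_pred_atom[of "Rel r [0..<k]" B k] assms by (auto simp: lessThan_atLeast0)

lemma pp_pred_less:
  assumes "pp_definable B 2 less_rel" "i < k" "j < k"
  shows "pp_pred B k (\<lambda>\<sigma>. \<sigma> i < \<sigma> j)"
proof -
  have "pp_pred B k (\<lambda>\<sigma>. map (\<lambda>l. \<sigma> ((\<lambda>l. if l = 0 then i else j) l)) [0..<2] \<in> less_rel)"
    using assms by (intro pp_pred_rename[OF pp_definableD]) auto
  then show ?thesis
    by (simp add: less_rel_def upt_rec)
qed


section \<open>The dense order of the rationals\<close>

lemma finite_gap:
  fixes A C :: "rat set"
  assumes "finite A" "finite C" "\<And>a c. a \<in> A \<Longrightarrow> c \<in> C \<Longrightarrow> a < c"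
  obtains q where "\<And>a. a \<in> A \<Longrightarrow> a < q" "\<And>c. c \<in> C \<Longrightarrow> q < c"
proof (cases "A = {} \<or> C = {}")
  case True
  then show ?thesis
  proof
    assume "A = {}"
    \<comment> \<open>Inserting \<open>0\<close> keeps the minimum meaningful when \<open>C\<close>
      is empty too.\<close>
    moreover have "Min (insert 0 C) - 1 < c" if "c \<in> C" for c
      using Min_le[of "insert 0 C", OF finite.insertI[OF assms(2)] insertI2[OF that]] by linarith
    ultimately show ?thesis using that[of "Min (insert 0 C) - 1"] by blast
  next
    assume "C = {}"
    moreover have "a < Max (insert 0 A) + 1" if "a \<in> A" for a
      using Max_ge[of "insert 0 A", OF finite.insertI[OF assms(1)] insertI2[OF that]] by linarith
    ultimately show ?thesis using that[of "Max (insert 0 A) + 1"] by blast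
  qed
next
  case False
  then have "Max A < Min C" using assms by simp
  then obtain q where "Max A < q" "q < Min C" using dense by blast
  with that[of q] False assms(1,2) show ?thesis by auto
qed

text \<open>One back-and-forth step: if \<open>a\<close> is a value of \<open>\<sigma>\<close>, the
  corresponding value of \<open>\<tau>\<close> answers it; otherwise any point of the corresponding
  gap does.\<close>

lemma order_type_extend:
  fixes \<sigma> \<tau> :: "nat \<Rightarrow> rat"
  assumes "finite V" "\<And>i j. i \<in> V \<Longrightarrow> j \<in> V \<Longrightarrow> \<sigma> i < \<sigma> j \<longleftrightarrow> \<tau> i < \<tau> j"
  obtains b where "\<And>i. i \<in> V \<Longrightarrow> \<sigma> i < a \<longleftrightarrow> \<tau> i < b" "\<And>i. i \<in> V \<Longrightarrow> a < \<sigma> i \<longleftrightarrow> b < \<tau> i"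
proof (cases "\<exists>i\<in>V. \<sigma> i = a")
  case True
  then obtain i where "i \<in> V" "\<sigma> i = a" by blast
  with assms(2) show ?thesis by (intro that[of "\<tau> i"]) auto
next
  case False
  have fin: "finite (\<tau> ` {i \<in> V. \<sigma> i < a})" "finite (\<tau> ` {i \<in> V. a < \<sigma> i})"
    using assms(1) by auto
  have "x < y" if "x \<in> \<tau> ` {i \<in> V. \<sigma> i < a}" "y \<in> \<tau> ` {i \<in> V. a < \<sigma> i}" for x y
    using that assms(2) by (auto dest: order.strict_trans)
  then obtain q where q: "\<And>x. x \<in> \<tau> ` {i \<in> V. \<sigma> i < a} \<Longrightarrow> x < q" "\<And>y. y \<in> \<tau> ` {i \<in> V. a < \<sigma> i} \<Longrightarrow> q < y"
    using finite_gap[OF fin] by blast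
  have "\<sigma> i < a \<and> \<tau> i < q \<or> a < \<sigma> i \<and> q < \<tau> i" if "i \<in> V" for i
    using q False that by (cases "\<sigma> i" a rule: linorder_cases) auto
  then show ?thesis
    by (intro that[of q]) (meson order.asym)+
qed

text \<open>Truth in the rational order depends only on the order type of the free variables.
  Equality is read off as the failure of both strict comparisons; quantifiers are handled by the
  back-and-forth step.\<close>

lemma sat_rat_order_cong:
  "(\<And>i j. i \<in> free_vars \<phi> \<Longrightarrow> j \<in> free_vars \<phi> \<Longrightarrow> \<sigma> i < \<sigma> j \<longleftrightarrow> \<tau> i < \<tau> j) \<Longrightarrow>
    wf_fo rat_order \<phi> \<Longrightarrow> sat rat_order \<sigma> \<phi> \<longleftrightarrow> sat rat_order \<tau> \<phi>"
proof (induction \<phi> arbitrary: \<sigma> \<tau>)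
  case (Rel r xs)
  then obtain i j where "xs = [i, j]"
    by (auto simp: rat_order_def numeral_2_eq_2 length_Suc_conv)
  with Rel show ?case by (auto simp: rat_order_def less_rel_def)
next
  case (Eq x y)
  then have "\<sigma> x < \<sigma> y \<longleftrightarrow> \<tau> x < \<tau> y" "\<sigma> y < \<sigma> x \<longleftrightarrow> \<tau> y < \<tau> x" by simp_all
  then show ?case by auto
next
  case (Neg \<phi>)
  then have "sat rat_order \<sigma> \<phi> \<longleftrightarrow> sat rat_order \<tau> \<phi>" by (intro Neg.IH) auto
  then show ?case by simp
next
  case (Conj \<phi>s)
  have "sat rat_order \<sigma> \<phi> \<longleftrightarrow> sat rat_order \<tau> \<phi>" if "\<phi> \<in> set \<phi>s" for \<phi>
    using that Conj.prems by (intro Conj.IH) auto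
  then show ?case by simp
next
  case (Ex x \<phi>)
  \<comment> \<open>Stated for arbitrary assignments so that it can be used in both
    directions.\<close>
  have *: "sat rat_order \<tau> (Ex x \<phi>)"
    if sat: "sat rat_order \<sigma> (Ex x \<phi>)"
      and eq: "\<And>i j. i \<in> free_vars (Ex x \<phi>) \<Longrightarrow> j \<in> free_vars (Ex x \<phi>) \<Longrightarrow> \<sigma> i < \<sigma> j \<longleftrightarrow> \<tau> i < \<tau> j"
    for \<sigma> \<tau>
  proof -
    obtain a where a: "sat rat_order (\<sigma>(x := a)) \<phi>"
      using sat by auto
    obtain b where b: "\<And>i. i \<in> free_vars (Ex x \<phi>) \<Longrightarrow> \<sigma> i < a \<longleftrightarrow> \<tau> i < b"
      "\<And>i. i \<in> free_vars (Ex x \<phi>) \<Longrightarrow> a < \<sigma> i \<longleftrightarrow> b < \<tau> i"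
      using order_type_extend[of "free_vars (Ex x \<phi>)" \<sigma> \<tau> a, OF finite_free_vars eq] by blast
    have "sat rat_order (\<sigma>(x := a)) \<phi> \<longleftrightarrow> sat rat_order (\<tau>(x := b)) \<phi>"
      using Ex.prems(2) b eq by (intro Ex.IH) auto
    with a show ?thesis by auto
  qed
  show ?case
    using *[of \<sigma> \<tau>] *[of \<tau> \<sigma>] Ex.prems(1) by blast
qed

lemma fo_definable_rat_order_cong:
  assumes "fo_definable rat_order k R" "length s = k" "length t = k"
    "\<And>i j. i < k \<Longrightarrow> j < k \<Longrightarrow> s ! i < s ! j \<longleftrightarrow> t ! i < t ! j"
  shows "s \<in> R \<longleftrightarrow> t \<in> R"
proof -
  obtain \<phi> where \<phi>: "wf_fo rat_order \<phi>" "free_vars \<phi> \<subseteq> {..<k}"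
    "R = {t. length t = k \<and> sat rat_order (\<lambda>i. t ! i) \<phi>}"
    using assms(1) unfolding fo_definable_def defines_rel_def by blast
  have "sat rat_order (\<lambda>i. s ! i) \<phi> \<longleftrightarrow> sat rat_order (\<lambda>i. t ! i) \<phi>"
    using \<phi>(1,2) assms(4) by (intro sat_rat_order_cong) auto
  with \<phi>(3) assms(2,3) show ?thesis by simp
qed

section \<open>Embedding countable orders, and an injective operation increasing in the sum\<close>

text \<open>Cantor's construction: the image of \<open>n\<close> is chosen in the gap left by the
  images of the smaller numbers. The range \<open>{..<n}\<close> confines the recursion to earlier
  values.\<close>

fun rat_embedding :: "(nat \<Rightarrow> nat \<Rightarrow> bool) \<Rightarrow> nat \<Rightarrow> rat" where
  "rat_embedding L n = (SOME q. \<forall>i\<in>{..<n}.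
     (L i n \<longrightarrow> rat_embedding L i < q) \<and> (L n i \<longrightarrow> q < rat_embedding L i))"

declare rat_embedding.simps [simp del]

lemma rat_embedding_less:
  assumes irrefl: "\<And>i. \<not> L i i" and trans: "\<And>i j l. L i j \<Longrightarrow> L j l \<Longrightarrow> L i l"
    and "L i j"
  shows "rat_embedding L i < rat_embedding L j"
proof -
  have "\<forall>i<n. \<forall>j<n. L i j \<longrightarrow> rat_embedding L i < rat_embedding L j" for n
  proof (induction n)
    case (Suc n)
    have fin: "finite (rat_embedding L ` {i. i < n \<and> L i n})" "finite (rat_embedding L ` {i. i < n \<and> L n i})"
      by auto
    \<comment> \<open>Transitivity through \<open>n\<close> compares the two preimages, and the
      induction hypothesis their images; so the gap exists and the choice in
      \<open>rat_embedding\<close> succeeds.\<close>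
    have "x < y" if "x \<in> rat_embedding L ` {i. i < n \<and> L i n}" "y \<in> rat_embedding L ` {i. i < n \<and> L n i}" for x y
      using that Suc.IH trans by blast
    then obtain q where "\<And>x. x \<in> rat_embedding L ` {i. i < n \<and> L i n} \<Longrightarrow> x < q"
      "\<And>y. y \<in> rat_embedding L ` {i. i < n \<and> L n i} \<Longrightarrow> q < y"
      using finite_gap[OF fin] by blast
    then have "\<forall>i\<in>{..<n}. (L i n \<longrightarrow> rat_embedding L i < q) \<and> (L n i \<longrightarrow> q < rat_embedding L i)"
      by auto
    then have "\<forall>i\<in>{..<n}. (L i n \<longrightarrow> rat_embedding L i < rat_embedding L n) \<and>
        (L n i \<longrightarrow> rat_embedding L n < rat_embedding L i)"
      unfolding rat_embedding.simps[of L n] by (rule someI)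
    with Suc.IH irrefl show ?case by (auto simp: less_Suc_eq)
  qed simp
  from this[of "Suc (max i j)"] \<open>L i j\<close> show ?thesis
    by (simp add: less_Suc_eq_le)
qed

lemma injective_sum_monotone_op:
  obtains f :: "rat \<Rightarrow> rat \<Rightarrow> rat"
  where "injective2 f" "preserves_le f" "\<And>a b c d. a + b < c + d \<Longrightarrow> f a b < f c d"
proof -
  \<comment> \<open>Lexicographic by sum, then first component. The order is linear, whence
    injectivity, and extends the product order, whence monotonicity.\<close>
  define lt :: "rat \<times> rat \<Rightarrow> rat \<times> rat \<Rightarrow> bool" where
    "lt = (\<lambda>(a, b) (c, d). a + b < c + d \<or> a + b = c + d \<and> a < c)"
  define L where "L = (\<lambda>i j. lt (from_nat i) (from_nat j))"
  define f :: "rat \<Rightarrow> rat \<Rightarrow> rat" where "f = (\<lambda>a b. rat_embedding L (to_nat (a, b)))"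
  have lt: "f a b < f c d" if "lt (a, b) (c, d)" for a b c d
    unfolding f_def
    by (rule rat_embedding_less) (use that in \<open>auto simp: L_def lt_def\<close>)
  have "injective2 f"
    unfolding injective2_def
  proof (rule injI, clarsimp)
    fix a b c d
    assume "f a b = f c d"
    then have "\<not> lt (a, b) (c, d)" "\<not> lt (c, d) (a, b)"
      using lt by fastforce+
    then show "a = c \<and> b = d" by (auto simp: lt_def)
  qed
  moreover have "preserves_le f"
    unfolding preserves_le_def
  proof clarify
    fix a a' b b' :: rat
    assume "a \<le> a'" "b \<le> b'"
    then have "lt (a, b) (a', b') \<or> a = a' \<and> b = b'"
      by (auto simp: lt_def)
    then show "f a b \<le> f a' b'"
      using lt by (auto intro: less_imp_le)
  qed
  ultimately show ?thesis
    using that lt by (simp add: lt_def)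
qed


section \<open>Defining \<open>R_min\<close> and its dual\<close>

text \<open>The maps \<open>h\<close> need not be onto, which admits maps with a jump.\<close>

definition order_invariant :: "((nat \<Rightarrow> rat) \<Rightarrow> bool) \<Rightarrow> bool" where
  "order_invariant Q \<longleftrightarrow> (\<forall>h \<sigma>. strict_mono h \<longrightarrow> Q \<sigma> \<longrightarrow> Q (\<lambda>i. h (\<sigma> i)))"

text \<open>Cutting an assignment at \<open>v\<close>, the part below \<open>v\<close> can be moved to the left of \<open>x\<close>, with
  everything from \<open>w\<close> onwards staying to the right of \<open>y\<close>, and the rest beyond any bound \<open>M\<close>.\<close>

lemma order_invariant_cut:
  fixes x y M v w :: rat
  assumes "order_invariant Q" "Q \<sigma>" "y < x" "w < v"
  obtains \<tau> where "Q \<tau>" "\<And>i. \<sigma> i < v \<Longrightarrow> \<tau> i < x"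
    "\<And>i. v \<le> \<sigma> i \<Longrightarrow> M < \<tau> i" "\<And>i. w \<le> \<sigma> i \<Longrightarrow> y < \<tau> i"
proof -
  \<comment> \<open>With slope \<open>e\<close>, the interval from \<open>w\<close> to
    \<open>v\<close> shrinks to half the distance from \<open>y\<close> to \<open>x\<close>.\<close>
  define e where "e = (x - y) / (2 * (v - w))"
  have "e * (v - w) = (x - y) / 2"
    using assms(4) by (simp add: e_def divide_simps)
  also have "\<dots> < x - y"
    using assms(3) by simp
  finally have e: "e * (v - w) < x - y" "e > 0"
    using assms(3,4) by (simp_all add: e_def del: times_divide_eq_left)
  \<comment> \<open>Below \<open>v\<close> an affine map approaching \<open>x\<close>; at
    \<open>v\<close> a jump beyond both \<open>x\<close> and \<open>M\<close>, followed by a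
    translation.\<close>
  define h where "h = (\<lambda>u. if u < v then x - e * (v - u) else max x M + 1 + (u - v))"
  have h: "strict_mono h"
  proof (rule strict_monoI)
    fix s t :: rat
    assume "s < t"
    moreover have "x - e * (v - s) < max x M + 1 + (t - v)" if "s < v" "v \<le> t"
    proof -
      have "e * (v - s) > 0" using e(2) that by simp
      with that show ?thesis by (simp add: max_def)
    qed
    ultimately show "h s < h t"
      using e(2) by (auto simp: h_def)
  qed
  have "y < h u" if "w \<le> u" for u
  proof -
    have "y < h w" using e(1) assms(4) by (simp add: h_def)
    also have "\<dots> \<le> h u" using h that by (simp add: strict_mono_less_eq)
    finally show ?thesis .
  qed
  moreover have "h u < x" if "u < v" for u
    using that e(2) by (simp add: h_def)
  moreover have "M < h u" if "v \<le> u" for u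
    using that by (simp add: h_def)
  moreover have "Q (\<lambda>i. h (\<sigma> i))"
    using assms(1,2) h unfolding order_invariant_def by blast
  ultimately show ?thesis
    using that[of "\<lambda>i. h (\<sigma> i)"] by simp
qed

text \<open>Conjugation by negation keeps maps strictly increasing, so the cut can be applied to the
  dual relation.\<close>

lemma order_invariant_uminus:
  assumes "order_invariant Q"
  shows "order_invariant (\<lambda>\<sigma>. Q (\<lambda>i. - \<sigma> i))"
  unfolding order_invariant_def
proof clarify
  fix h :: "rat \<Rightarrow> rat" and \<sigma> :: "nat \<Rightarrow> rat"
  assume "strict_mono h" "Q (\<lambda>i. - \<sigma> i)"
  moreover from \<open>strict_mono h\<close> have "strict_mono (\<lambda>u. - h (- u))"
    by (simp add: strict_mono_def)
  ultimately have "Q (\<lambda>i. - h (- (- \<sigma> i)))"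
    using assms unfolding order_invariant_def by blast
  then show "Q (\<lambda>i. - h (\<sigma> i))" by simp
qed

lemma mem_R_min: "[x, y, z] \<in> R_min \<longleftrightarrow> y < x \<or> z < x"
  by (auto simp: R_min_def)

lemma mem_neg_R_min: "[x, y, z] \<in> neg_rel R_min \<longleftrightarrow> x < y \<or> x < z"
proof
  assume "x < y \<or> x < z"
  then have "[- x, - y, - z] \<in> R_min" by (simp add: mem_R_min)
  then have "map uminus [- x, - y, - z] \<in> neg_rel R_min"
    unfolding neg_rel_def by blast
  then show "[x, y, z] \<in> neg_rel R_min" by simp
qed (auto simp: neg_rel_def R_min_def)

lemma pp_definable_3I:
  assumes "pp_pred B n P" "3 \<le> n" "\<And>t. t \<in> R \<Longrightarrow> length t = 3"
    "\<And>x y z. [x, y, z] \<in> R \<longleftrightarrow> (\<exists>\<tau>. \<tau> 0 = x \<and> \<tau> 1 = y \<and> \<tau> 2 = z \<and> P \<tau>)"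
  shows "pp_definable B 3 R"
proof (rule pp_definableI[OF pp_pred_project[OF assms(1,2)]])
  have "t \<in> R \<longleftrightarrow> length t = 3 \<and> (\<exists>\<tau>. (\<forall>i<3. \<tau> i = t ! i) \<and> P \<tau>)" for t
  proof (cases "length t = 3")
    case True
    then obtain x y z where t: "t = [x, y, z]"
      by (auto simp: numeral_3_eq_3 length_Suc_conv)
    have "(\<forall>i<3. \<tau> i = t ! i) \<longleftrightarrow> \<tau> 0 = x \<and> \<tau> 1 = y \<and> \<tau> 2 = z" for \<tau>
      by (auto simp: t numeral_3_eq_3 numeral_2_eq_2 less_Suc_eq)
    with assms(4) t show ?thesis by auto
  qed (use assms(3) in auto)
  then show "R = {t. length t = 3 \<and> (\<exists>\<tau>. (\<forall>i<3. \<tau> i = t ! i) \<and> P \<tau>)}" by blast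
qed

lemma length_R_min: "t \<in> R_min \<Longrightarrow> length t = 3" "t \<in> neg_rel R_min \<Longrightarrow> length t = 3"
  by (auto simp: R_min_def neg_rel_def)

section \<open>Three configurations that define \<open>R_min\<close> or its dual\<close>

text \<open>\<open>R_min\<close> is defined by a copy of \<open>Q\<close> with \<open>a\<close>
  below \<open>x\<close>, \<open>b\<close> above \<open>y\<close> and \<open>d\<close> above
  \<open>z\<close>. If \<open>x \<le> y\<close> and \<open>x \<le> z\<close>, it would satisfy both
  excluded inequalities. If \<open>y < x\<close>, a solution with \<open>a < d\<close> has
  \<open>b \<le> a\<close>, and a cut at \<open>d\<close> places all three points.\<close>

lemma R_min_of_common_source:
  assumes less: "pp_definable B 2 less_rel" and Q: "pp_pred B k Q" "order_invariant Q"
    and k: "a < k" "b < k" "d < k"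
    and sat: "\<exists>\<sigma>. Q \<sigma> \<and> \<sigma> a < \<sigma> b" "\<exists>\<sigma>. Q \<sigma> \<and> \<sigma> a < \<sigma> d"
    and unsat: "\<not> (\<exists>\<sigma>. Q \<sigma> \<and> \<sigma> a < \<sigma> b \<and> \<sigma> a < \<sigma> d)"
  shows "pp_definable B 3 R_min"
proof -
  define P where "P = (\<lambda>\<tau>. Q (\<lambda>i. \<tau> (3 + i)) \<and> \<tau> (3 + a) < \<tau> 0 \<and> \<tau> 1 < \<tau> (3 + b) \<and> \<tau> 2 < \<tau> (3 + d))"
  have "pp_pred B (3 + k) P"
    unfolding P_def using k
    by (intro pp_pred_conj pp_pred_less[OF less] pp_pred_rename[OF Q(1)]) auto
  \<comment> \<open>\<open>b\<close> and \<open>d\<close> are generalized because the case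
    \<open>z < x\<close> uses them exchanged.\<close>
  moreover have main: "\<exists>\<tau>. Q \<tau> \<and> \<tau> a < x \<and> y < \<tau> b \<and> z < \<tau> d"
    if "y < x" and ad: "\<exists>\<sigma>. Q \<sigma> \<and> \<sigma> a < \<sigma> d" and un: "\<not> (\<exists>\<sigma>. Q \<sigma> \<and> \<sigma> a < \<sigma> b \<and> \<sigma> a < \<sigma> d)"
    for x y z b d
  proof -
    obtain \<sigma> where \<sigma>: "Q \<sigma>" "\<sigma> a < \<sigma> d" using ad by blast
    then have "\<sigma> b \<le> \<sigma> a" using un by force
    then have "\<sigma> b < \<sigma> d" using \<sigma>(2) by simp
    then obtain \<tau> where \<tau>: "Q \<tau>" "\<And>i. \<sigma> i < \<sigma> d \<Longrightarrow> \<tau> i < x" "\<And>i. \<sigma> d \<le> \<sigma> i \<Longrightarrow> z < \<tau> i"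
        "\<And>i. \<sigma> b \<le> \<sigma> i \<Longrightarrow> y < \<tau> i"
      by (rule order_invariant_cut[OF Q(2) \<sigma>(1) \<open>y < x\<close>, where M = z]) blast
    then have "\<tau> a < x" "y < \<tau> b" "z < \<tau> d"
      using \<sigma>(2) by simp_all
    with \<tau>(1) show ?thesis by blast
  qed
  have "[x, y, z] \<in> R_min \<longleftrightarrow> (\<exists>\<tau>. \<tau> 0 = x \<and> \<tau> 1 = y \<and> \<tau> 2 = z \<and> P \<tau>)" for x y z
  proof
    assume "[x, y, z] \<in> R_min"
    then consider "y < x" | "z < x" by (auto simp: mem_R_min)
    then have "\<exists>\<sigma>. Q \<sigma> \<and> \<sigma> a < x \<and> y < \<sigma> b \<and> z < \<sigma> d"
    proof cases
      case 1
      then show ?thesis using main[of y x d b z] sat unsat by blast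
    next
      case 2
      then show ?thesis using main[of z x b d y] sat unsat by blast
    qed
    then obtain \<sigma> where "Q \<sigma>" "\<sigma> a < x" "y < \<sigma> b" "z < \<sigma> d" by blast
    then have "P (\<lambda>i. if i < 3 then [x, y, z] ! i else \<sigma> (i - 3))"
      by (simp add: P_def)
    then show "\<exists>\<tau>. \<tau> 0 = x \<and> \<tau> 1 = y \<and> \<tau> 2 = z \<and> P \<tau>"
      by (intro exI[of _ "\<lambda>i. if i < 3 then [x, y, z] ! i else \<sigma> (i - 3)"]) simp
  next
    assume "\<exists>\<tau>. \<tau> 0 = x \<and> \<tau> 1 = y \<and> \<tau> 2 = z \<and> P \<tau>"
    then obtain \<tau> where "\<tau> 0 = x" "\<tau> 1 = y" "\<tau> 2 = z" "P \<tau>" by blast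
    moreover define \<sigma> where "\<sigma> = (\<lambda>i. \<tau> (3 + i))"
    ultimately have "Q \<sigma>" "\<sigma> a < x" "y < \<sigma> b" "z < \<sigma> d"
      by (simp_all add: P_def)
    moreover from this have "\<sigma> b \<le> \<sigma> a \<or> \<sigma> d \<le> \<sigma> a"
      using unsat by force
    ultimately show "[x, y, z] \<in> R_min" by (auto simp: mem_R_min)
  qed
  ultimately show ?thesis
    by (intro pp_definable_3I[of B "3 + k" P]) (simp_all add: length_R_min)
qed

text \<open>Mirror image of the common source: \<open>d\<close> lies above \<open>x\<close>, while
  \<open>a\<close> and \<open>c\<close> lie below \<open>y\<close> and \<open>z\<close>.\<close>

lemma neg_R_min_of_common_target:
  assumes less: "pp_definable B 2 less_rel" and Q: "pp_pred B k Q" "order_invariant Q"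
    and k: "a < k" "c < k" "d < k"
    and sat: "\<exists>\<sigma>. Q \<sigma> \<and> \<sigma> a < \<sigma> d" "\<exists>\<sigma>. Q \<sigma> \<and> \<sigma> c < \<sigma> d"
    and unsat: "\<not> (\<exists>\<sigma>. Q \<sigma> \<and> \<sigma> a < \<sigma> d \<and> \<sigma> c < \<sigma> d)"
  shows "pp_definable B 3 (neg_rel R_min)"
proof -
  define P where "P = (\<lambda>\<tau>. Q (\<lambda>i. \<tau> (3 + i)) \<and> \<tau> 0 < \<tau> (3 + d) \<and> \<tau> (3 + a) < \<tau> 1 \<and> \<tau> (3 + c) < \<tau> 2)"
  have "pp_pred B (3 + k) P"
    unfolding P_def using k
    by (intro pp_pred_conj pp_pred_less[OF less] pp_pred_rename[OF Q(1)]) auto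
  moreover have main: "\<exists>\<tau>. Q \<tau> \<and> x < \<tau> d \<and> \<tau> a < y \<and> \<tau> c < z"
    if xy: "x < y" and cd: "\<exists>\<sigma>. Q \<sigma> \<and> \<sigma> c < \<sigma> d" and un: "\<not> (\<exists>\<sigma>. Q \<sigma> \<and> \<sigma> a < \<sigma> d \<and> \<sigma> c < \<sigma> d)"
    for x y z a c
  proof -
    obtain \<sigma> where \<sigma>: "Q \<sigma>" "\<sigma> c < \<sigma> d" using cd by blast
    then have "\<sigma> d \<le> \<sigma> a" using un by force
    \<comment> \<open>Here \<open>c < d \<le> a\<close>; the negated solution is cut at the value of
      \<open>c\<close>, with \<open>a\<close> kept on the near side of \<open>y\<close>.\<close>
    then have *: "- \<sigma> a < - \<sigma> c" using \<sigma>(2) by simp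
    have yx: "- y < - x" and "Q (\<lambda>i. - (- \<sigma> i))" using xy \<sigma>(1) by simp_all
    obtain \<tau> where \<tau>: "Q (\<lambda>i. - \<tau> i)" "\<And>i. - \<sigma> i < - \<sigma> c \<Longrightarrow> \<tau> i < - x"
      "\<And>i. - \<sigma> c \<le> - \<sigma> i \<Longrightarrow> - z < \<tau> i" "\<And>i. - \<sigma> a \<le> - \<sigma> i \<Longrightarrow> - y < \<tau> i"
      by (rule order_invariant_cut[OF order_invariant_uminus[OF Q(2)] \<open>Q (\<lambda>i. - (- \<sigma> i))\<close> yx *, where M = "- z"]) blast
    have "\<tau> d < - x" "- z < \<tau> c" "- y < \<tau> a"
      using \<tau>(2-4) \<sigma>(2) by simp_all
    with \<tau>(1) show ?thesis
      by (intro exI[of _ "\<lambda>i. - \<tau> i"]) simp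
  qed
  have "[x, y, z] \<in> neg_rel R_min \<longleftrightarrow> (\<exists>\<tau>. \<tau> 0 = x \<and> \<tau> 1 = y \<and> \<tau> 2 = z \<and> P \<tau>)" for x y z
  proof
    assume "[x, y, z] \<in> neg_rel R_min"
    then consider "x < y" | "x < z" by (auto simp: mem_neg_R_min)
    then have "\<exists>\<sigma>. Q \<sigma> \<and> x < \<sigma> d \<and> \<sigma> a < y \<and> \<sigma> c < z"
    proof cases
      case 1
      then show ?thesis using main[of x y c a z] sat unsat by blast
    next
      case 2
      then show ?thesis using main[of x z a c y] sat unsat by blast
    qed
    then obtain \<sigma> where "Q \<sigma>" "x < \<sigma> d" "\<sigma> a < y" "\<sigma> c < z" by blast
    then have "P (\<lambda>i. if i < 3 then [x, y, z] ! i else \<sigma> (i - 3))"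
      by (simp add: P_def)
    then show "\<exists>\<tau>. \<tau> 0 = x \<and> \<tau> 1 = y \<and> \<tau> 2 = z \<and> P \<tau>"
      by (intro exI[of _ "\<lambda>i. if i < 3 then [x, y, z] ! i else \<sigma> (i - 3)"]) simp
  next
    assume "\<exists>\<tau>. \<tau> 0 = x \<and> \<tau> 1 = y \<and> \<tau> 2 = z \<and> P \<tau>"
    then obtain \<tau> where "\<tau> 0 = x" "\<tau> 1 = y" "\<tau> 2 = z" "P \<tau>" by blast
    moreover define \<sigma> where "\<sigma> = (\<lambda>i. \<tau> (3 + i))"
    ultimately have "Q \<sigma>" "x < \<sigma> d" "\<sigma> a < y" "\<sigma> c < z"
      by (simp_all add: P_def)
    moreover from this have "\<sigma> d \<le> \<sigma> a \<or> \<sigma> d \<le> \<sigma> c"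
      using unsat by force
    ultimately show "[x, y, z] \<in> neg_rel R_min" by (auto simp: mem_neg_R_min)
  qed
  ultimately show ?thesis
    by (intro pp_definable_3I[of B "3 + k" P]) (simp_all add: length_R_min)
qed

text \<open>The defining formula couples two copies \<open>p\<close>, \<open>q\<close> of \<open>Q\<close> crosswise: if \<open>x \<le> y\<close> and
  \<open>x \<le> z\<close>, then both copies satisfy \<open>a < b\<close>, hence \<open>d \<le> c\<close>, and
  \<open>p d \<le> p c < q d \<le> q c < p d\<close> is a contradiction.\<close>

lemma R_min_of_crossing:
  assumes less: "pp_definable B 2 less_rel" and Q: "pp_pred B k Q" "order_invariant Q"
    and k: "a < k" "b < k" "c < k" "d < k"
    and sat: "\<exists>\<sigma>. Q \<sigma> \<and> \<sigma> a < \<sigma> b \<and> \<sigma> a < \<sigma> d" "\<exists>\<sigma>. Q \<sigma> \<and> \<sigma> a < \<sigma> d \<and> \<sigma> c < \<sigma> d"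
    and unsat: "\<not> (\<exists>\<sigma>. Q \<sigma> \<and> \<sigma> a < \<sigma> b \<and> \<sigma> c < \<sigma> d)"
  shows "pp_definable B 3 R_min"
proof -
  define T where "T = (\<lambda>x y z p q. Q p \<and> Q q \<and> p a < x \<and> y < p b \<and> q a < x \<and> z < q b \<and>
    p c < q d \<and> q c < p d)"
  define P where "P = (\<lambda>\<tau>. T (\<tau> 0) (\<tau> 1) (\<tau> 2) (\<lambda>i. \<tau> (3 + i)) (\<lambda>i. \<tau> (3 + k + i)))"
  have "pp_pred B (3 + k + k) P"
    unfolding P_def T_def using k
    by (intro pp_pred_conj pp_pred_less[OF less] pp_pred_rename[OF Q(1)]) auto
  moreover have main: "\<exists>p q. T x y z p q" if "y < x" for x y z
  proof -
    obtain \<sigma> where \<sigma>: "Q \<sigma>" "\<sigma> a < \<sigma> b" "\<sigma> a < \<sigma> d" using sat(1) by blast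
    then have "\<sigma> a < min (\<sigma> b) (\<sigma> d)" by simp
    \<comment> \<open>The cut leaves \<open>a\<close> below \<open>x\<close> and lifts both
      \<open>b\<close> and \<open>d\<close> beyond \<open>x\<close> and \<open>z\<close>.\<close>
    then obtain q where q: "Q q" "\<And>i. \<sigma> i < min (\<sigma> b) (\<sigma> d) \<Longrightarrow> q i < x"
        "\<And>i. min (\<sigma> b) (\<sigma> d) \<le> \<sigma> i \<Longrightarrow> max x z < q i"
      by (rule order_invariant_cut[OF Q(2) \<sigma>(1) \<open>y < x\<close>, where M = "max x z"]) blast
    have q': "q a < x" "z < q b" "x < q d"
      using q(2)[of a] q(3)[of b] q(3)[of d] \<sigma> by simp_all
    obtain \<sigma> where \<sigma>: "Q \<sigma>" "\<sigma> a < \<sigma> d" "\<sigma> c < \<sigma> d" using sat(2) by blast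
    then have "\<sigma> b \<le> \<sigma> a" using unsat by force
    then have "\<sigma> b < \<sigma> d" using \<sigma>(2) by simp
    \<comment> \<open>Chosen after \<open>q\<close>, because \<open>d\<close> has to pass
      \<open>q c\<close>. The remaining coupling holds since \<open>p c < x < q d\<close>.\<close>
    then obtain p where
      p: "Q p" "\<And>i. \<sigma> i < \<sigma> d \<Longrightarrow> p i < x" "\<And>i. \<sigma> d \<le> \<sigma> i \<Longrightarrow> q c < p i" "\<And>i. \<sigma> b \<le> \<sigma> i \<Longrightarrow> y < p i"
      by (rule order_invariant_cut[OF Q(2) \<sigma>(1) \<open>y < x\<close>, where M = "q c"]) blast
    have "p a < x" "p c < x" "q c < p d" "y < p b"
      using p \<sigma> by simp_all
    with q(1) q' p(1) have "T x y z p q"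
      by (simp add: T_def)
    then show ?thesis by blast
  qed
  have "[x, y, z] \<in> R_min \<longleftrightarrow> (\<exists>\<tau>. \<tau> 0 = x \<and> \<tau> 1 = y \<and> \<tau> 2 = z \<and> P \<tau>)" for x y z
  proof
    assume "[x, y, z] \<in> R_min"
    then consider "y < x" | "z < x" by (auto simp: mem_R_min)
    then have "\<exists>p q. T x y z p q"
    proof cases
      case 1
      then show ?thesis by (rule main)
    next
      case 2
      then obtain p q where "T x z y p q" using main by blast
      \<comment> \<open>The coupling is symmetric under exchanging the copies together with
        \<open>y\<close> and \<open>z\<close>.\<close>
      then have "T x y z q p" by (simp add: T_def)
      then show ?thesis by blast
    qed
    then obtain p q where pq: "T x y z p q" by blast
    define \<tau> where "\<tau> = (\<lambda>i. if i < 3 then [x, y, z] ! i else if i < 3 + k then p (i - 3) else q (i - 3 - k))"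
    \<comment> \<open>The block for \<open>p\<close> has length \<open>k\<close>, so reading it back
      yields \<open>p\<close> only below \<open>k\<close>; this is all that \<open>Q\<close> depends
      on.\<close>
    define p' where "p' = (\<lambda>i. \<tau> (3 + i))"
    have "\<And>i. i < k \<Longrightarrow> p' i = p i" by (simp add: p'_def \<tau>_def)
    moreover from this have "Q p' \<longleftrightarrow> Q p"
      by (rule pp_pred_cong[OF Q(1)])
    ultimately have "T x y z p' q"
      using pq k by (simp add: T_def)
    then have "P \<tau>"
      unfolding p'_def by (simp add: P_def \<tau>_def)
    then show "\<exists>\<tau>. \<tau> 0 = x \<and> \<tau> 1 = y \<and> \<tau> 2 = z \<and> P \<tau>"
      by (intro exI[of _ \<tau>]) (simp add: \<tau>_def)
  next
    assume "\<exists>\<tau>. \<tau> 0 = x \<and> \<tau> 1 = y \<and> \<tau> 2 = z \<and> P \<tau>"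
    then obtain p q where T: "T x y z p q"
      unfolding P_def by blast
    show "[x, y, z] \<in> R_min"
    proof (rule ccontr)
      assume "[x, y, z] \<notin> R_min"
      then have "x \<le> y" "x \<le> z" by (auto simp: mem_R_min)
      with T have "p a < p b" "q a < q b" unfolding T_def by linarith+
      then have "p d \<le> p c" "q d \<le> q c"
        using T unsat unfolding T_def by force+
      with T show False unfolding T_def by linarith
    qed
  qed
  ultimately show ?thesis
    by (intro pp_definable_3I[of B "3 + k + k" P]) (simp_all add: length_R_min)
qed

section \<open>From a violated relation to a definition of \<open>R_min\<close> or its dual, and
  back\<close>

text \<open>The triples \<open>(1, 0, 3)\<close> and \<open>(1, 3, 0)\<close> of
  \<open>R_min\<close> have coordinate sums \<open>2, 3, 3\<close>, so \<open>f\<close> makes the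
  first entry strictly least. For the dual, the sums \<open>0, -2, -2\<close> make it strictly
  greatest.\<close>

lemma not_preserves_R_min:
  assumes f: "\<And>a b c d. a + b < c + d \<Longrightarrow> f a b < f c d" and "preserved_by B f"
  shows "\<not> pp_definable B 3 R_min" "\<not> pp_definable B 3 (neg_rel R_min)"
proof -
  have upt: "[0..<3] = [0, 1, 2::nat]" by (simp add: upt_rec)
  have pres: "[f x x', f y y', f z z'] \<in> R"
    if "pp_definable B 3 R" "[x, y, z] \<in> R" "[x', y', z'] \<in> R" for R x y z x' y' z'
    using pp_pred_preserved[OF pp_definableD[OF that(1)] assms(2), of "\<lambda>i. [x, y, z] ! i" "\<lambda>i. [x', y', z'] ! i"] that(2,3)
    by (simp add: upt)
  show "\<not> pp_definable B 3 R_min"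
  proof
    assume "pp_definable B 3 R_min"
    from pres[OF this, of 1 0 3 1 3 0] f[of 1 1 0 3] f[of 1 1 3 0] show False
      by (simp add: mem_R_min)
  qed
  show "\<not> pp_definable B 3 (neg_rel R_min)"
  proof
    assume "pp_definable B 3 (neg_rel R_min)"
    from pres[OF this, of 0 1 "- 3" 0 "- 3" 1] f[of 1 "- 3" 0 0] f[of "- 3" 1 0 0] show False
      by (simp add: mem_neg_R_min)
  qed
qed

lemma R_min_of_not_preserved:
  assumes B: "temporal_structure B" and less: "pp_definable B 2 less_rel"
    and f: "preserves_le f" "injective2 f" "\<not> preserved_by B f"
  shows "pp_definable B 3 R_min \<or> pp_definable B 3 (neg_rel R_min)"
proof -
  obtain r s t where r: "r \<in> symbols B" and st: "s \<in> interp B r" "t \<in> interp B r"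
    and nin: "map2 f s t \<notin> interp B r"
    using f(3) unfolding preserved_by_def preserves_rel_def by blast
  define k where "k = arity B r"
  have fo: "fo_definable rat_order k (interp B r)" and len: "length s = k" "length t = k"
    using B r st unfolding temporal_structure_def relational_structure_def k_def by auto
  define u where "u = (\<lambda>i. f (s ! i) (t ! i))"
  have u: "map2 f s t = map u [0..<k]"
    using len by (auto intro: nth_equalityI simp: u_def)
  define I where "I = {(i, j). i < k \<and> j < k \<and> u i = u j}"
  define E where "E = {(i, j). i < k \<and> j < k \<and> u i < u j}"
  have "I \<subseteq> {..<k} \<times> {..<k}" "E \<subseteq> {..<k} \<times> {..<k}"
    by (auto simp: I_def E_def)
  then have fin: "finite I" "finite E"
    by (auto intro: finite_subset)
  define P where "P = (\<lambda>\<sigma>. map \<sigma> [0..<k] \<in> interp B r \<and> (\<forall>e\<in>I. \<sigma> (fst e) = \<sigma> (snd e)))"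
  have ppP: "pp_pred B k P"
  proof -
    have "pp_pred B k (\<lambda>\<sigma>. \<sigma> (fst e) = \<sigma> (snd e))" if "e \<in> I" for e
      using pp_pred_atom[of "Eq (fst e) (snd e)" B k] that by (auto simp: I_def)
    then show ?thesis
      unfolding P_def using fin(1) pp_pred_interp[OF r, of k]
      by (intro pp_pred_conj pp_pred_Ball) (auto simp: k_def)
  qed
  have invP: "order_invariant P"
    unfolding order_invariant_def
  proof clarify
    fix h :: "rat \<Rightarrow> rat" and \<sigma> :: "nat \<Rightarrow> rat"
    assume h: "strict_mono h" and \<sigma>: "P \<sigma>"
    have "map \<sigma> [0..<k] \<in> interp B r \<longleftrightarrow> map (\<lambda>i. h (\<sigma> i)) [0..<k] \<in> interp B r"
      using h by (intro fo_definable_rat_order_cong[OF fo]) (auto simp: strict_mono_less)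
    with \<sigma> show "P (\<lambda>i. h (\<sigma> i))" unfolding P_def by simp
  qed
  have Pst: "P (\<lambda>i. s ! i)" "P (\<lambda>i. t ! i)"
  proof -
    have "map (\<lambda>i. s ! i) [0..<k] = s" "map (\<lambda>i. t ! i) [0..<k] = t"
      using len by (auto intro: nth_equalityI)
    \<comment> \<open>Injectivity makes \<open>s\<close> and \<open>t\<close> inherit every equality
      between coordinates of \<open>u\<close>.\<close>
    moreover have "s ! i = s ! j \<and> t ! i = t ! j" if "(i, j) \<in> I" for i j
      using that injD[OF f(2)[unfolded injective2_def], of "(s ! i, t ! i)" "(s ! j, t ! j)"]
      by (auto simp: I_def u_def)
    ultimately show "P (\<lambda>i. s ! i)" "P (\<lambda>i. t ! i)"
      using st unfolding P_def by auto
  qed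
  have single: "\<exists>\<sigma>. P \<sigma> \<and> \<sigma> (fst e) < \<sigma> (snd e)" if "e \<in> E" for e
  proof -
    obtain i j where e: "e = (i, j)" by fastforce
    \<comment> \<open>Monotonicity: if both \<open>s\<close> and \<open>t\<close> failed the
      inequality, so would \<open>u\<close>.\<close>
    have "s ! i < s ! j \<or> t ! i < t ! j"
    proof (rule ccontr)
      assume "\<not> (s ! i < s ! j \<or> t ! i < t ! j)"
      then have "u j \<le> u i"
        using f(1) unfolding preserves_le_def u_def by simp
      with that e show False by (simp add: E_def)
    qed
    with Pst e show ?thesis by auto
  qed
  define bad where "bad = (\<lambda>F. F \<subseteq> E \<and> \<not> (\<exists>\<sigma>. P \<sigma> \<and> (\<forall>e\<in>F. \<sigma> (fst e) < \<sigma> (snd e))))"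
  have "bad E"
  proof -
    have False if \<sigma>: "P \<sigma>" and lt: "\<forall>e\<in>E. \<sigma> (fst e) < \<sigma> (snd e)" for \<sigma>
    proof -
      \<comment> \<open>Equalities from \<open>I\<close> and inequalities from \<open>E\<close> give
        \<open>\<sigma>\<close> the order type of \<open>u\<close>, which the relation
        omits.\<close>
      have "\<sigma> i < \<sigma> j \<longleftrightarrow> u i < u j" if "i < k" "j < k" for i j
      proof (cases "u i" "u j" rule: linorder_cases)
        case less
        then have "(i, j) \<in> E" using that by (simp add: E_def)
        with lt less show ?thesis by force
      next
        case equal
        then have "(i, j) \<in> I" using that by (simp add: I_def)
        with \<sigma> equal show ?thesis unfolding P_def by force
      next
        case greater
        then have "(j, i) \<in> E" using that by (simp add: E_def)
        with lt greater show ?thesis by force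
      qed
      then have "map \<sigma> [0..<k] \<in> interp B r \<longleftrightarrow> map u [0..<k] \<in> interp B r"
        by (intro fo_definable_rat_order_cong[OF fo]) auto
      with \<sigma> nin u show False by (simp add: P_def)
    qed
    then show ?thesis unfolding bad_def by blast
  qed
  then obtain F where F: "bad F" and min: "\<And>G. bad G \<Longrightarrow> card F \<le> card G"
    using ex_has_least_nat[of bad E card] by blast
  have "F \<subseteq> E" "finite F"
    using F fin(2) finite_subset unfolding bad_def by blast+
  \<comment> \<open>\<open>F\<close> has two members: \<open>s\<close> satisfies the empty set of
    constraints, and each single constraint is satisfiable.\<close>
  have "F \<noteq> {}"
    using F Pst(1) unfolding bad_def by auto
  then obtain e1 where e1: "e1 \<in> F" by blast
  have "F \<noteq> {e1}"
    using F single[of e1] unfolding bad_def by auto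
  then obtain e2 where e2: "e2 \<in> F" "e2 \<noteq> e1" using e1 by blast
  define Q where "Q = (\<lambda>\<sigma>. P \<sigma> \<and> (\<forall>e\<in>F - {e1, e2}. \<sigma> (fst e) < \<sigma> (snd e)))"
  have unsat: "\<not> (\<exists>\<sigma>. Q \<sigma> \<and> \<sigma> (fst e1) < \<sigma> (snd e1) \<and> \<sigma> (fst e2) < \<sigma> (snd e2))"
    using F unfolding bad_def Q_def by blast
  have ppQ: "pp_pred B k Q"
    unfolding Q_def using \<open>finite F\<close> \<open>F \<subseteq> E\<close>
    by (intro pp_pred_conj ppP pp_pred_Ball pp_pred_less[OF less]) (auto simp: E_def)
  have invQ: "order_invariant Q"
    using invP unfolding order_invariant_def Q_def by (auto simp: strict_mono_less)
  \<comment> \<open>Replacing two members of \<open>F\<close> by any one constraint of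
    \<open>E\<close> gives a smaller set, hence a satisfiable one. The constraint need not lie in
    \<open>F\<close>, as will matter for \<open>(a, d)\<close>.\<close>
  have sat: "\<exists>\<sigma>. Q \<sigma> \<and> \<sigma> i < \<sigma> j" if "(i, j) \<in> E" for i j
  proof -
    define G where "G = insert (i, j) (F - {e1, e2})"
    have "card {e1, e2} \<le> card F"
      using e1 e2 \<open>finite F\<close> by (intro card_mono) auto
    then have "card (F - {e1, e2}) + 2 \<le> card F"
      using e1 e2 by (simp add: card_Diff_subset)
    moreover have "card G \<le> card (F - {e1, e2}) + 1"
      unfolding G_def using \<open>finite F\<close> by (simp add: card_insert_if)
    ultimately have "\<not> bad G" using min[of G] by linarith
    moreover have "G \<subseteq> E" using that \<open>F \<subseteq> E\<close> by (auto simp: G_def)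
    ultimately show ?thesis unfolding bad_def G_def Q_def by auto
  qed
  have main: "pp_definable B 3 R_min \<or> pp_definable B 3 (neg_rel R_min)"
    if ab: "(a, b) \<in> E" and cd: "(c, d) \<in> E" and ac: "u a \<le> u c"
      and un: "\<not> (\<exists>\<sigma>. Q \<sigma> \<and> \<sigma> a < \<sigma> b \<and> \<sigma> c < \<sigma> d)" for a b c d
  proof -
    have k: "a < k" "b < k" "c < k" "d < k" using ab cd by (auto simp: E_def)
    \<comment> \<open>Because \<open>u a \<le> u c < u d\<close>.\<close>
    have ad: "(a, d) \<in> E" using ab cd ac by (auto simp: E_def)
    consider "\<not> (\<exists>\<sigma>. Q \<sigma> \<and> \<sigma> a < \<sigma> b \<and> \<sigma> a < \<sigma> d)" | "\<not> (\<exists>\<sigma>. Q \<sigma> \<and> \<sigma> a < \<sigma> d \<and> \<sigma> c < \<sigma> d)"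
      | "\<exists>\<sigma>. Q \<sigma> \<and> \<sigma> a < \<sigma> b \<and> \<sigma> a < \<sigma> d" "\<exists>\<sigma>. Q \<sigma> \<and> \<sigma> a < \<sigma> d \<and> \<sigma> c < \<sigma> d"
      by blast
    then show ?thesis
    proof cases
      case 1
      from R_min_of_common_source[OF less ppQ invQ k(1,2,4) sat[OF ab] sat[OF ad] 1] show ?thesis ..
    next
      case 2
      from neg_R_min_of_common_target[OF less ppQ invQ k(1,3,4) sat[OF ad] sat[OF cd] 2] show ?thesis ..
    next
      case 3
      from R_min_of_crossing[OF less ppQ invQ k 3 un] show ?thesis ..
    qed
  qed
  obtain a b c d where ab: "e1 = (a, b)" and cd: "e2 = (c, d)"
    by (cases e1; cases e2) auto
  have mem: "(a, b) \<in> E" "(c, d) \<in> E"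
    using e1 e2 \<open>F \<subseteq> E\<close> ab cd by auto
  show ?thesis
  \<comment> \<open>Exchanging the two constraints reduces to the case
    \<open>u a \<le> u c\<close>.\<close>
  proof (cases "u a \<le> u c")
    case True
    then show ?thesis using main[OF mem] unsat ab cd by auto
  next
    case False
    then show ?thesis using main[OF mem(2,1)] unsat ab cd by auto
  qed
qed

text \<open>That exactly one alternative holds is expressed as the equivalence of the first with the
  negation of the second.\<close>

theorem theorem6p6:
  fixes B :: "('r, rat) relstruct"
  assumes "temporal_structure B"
    and "pp_definable B 2 less_rel"
  shows "(pp_definable B 3 R_min \<or> pp_definable B 3 (neg_rel R_min)) \<longleftrightarrow>
         \<not> (\<forall>f :: rat \<Rightarrow> rat \<Rightarrow> rat. injective2 f \<and> preserves_le f \<longrightarrow> preserved_by B f)"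
proof
  assume L: "pp_definable B 3 R_min \<or> pp_definable B 3 (neg_rel R_min)"
  obtain f :: "rat \<Rightarrow> rat \<Rightarrow> rat" where f: "injective2 f" "preserves_le f"
    "\<And>a b c d. a + b < c + d \<Longrightarrow> f a b < f c d"
    by (rule injective_sum_monotone_op) blast
  then have "\<not> preserved_by B f"
    using not_preserves_R_min[of f B] L by blast
  with f(1,2) show "\<not> (\<forall>f :: rat \<Rightarrow> rat \<Rightarrow> rat. injective2 f \<and> preserves_le f \<longrightarrow> preserved_by B f)"
    by blast
next
  assume "\<not> (\<forall>f :: rat \<Rightarrow> rat \<Rightarrow> rat. injective2 f \<and> preserves_le f \<longrightarrow> preserved_by B f)"
  then show "pp_definable B 3 R_min \<or> pp_definable B 3 (neg_rel R_min)"
    using R_min_of_not_preserved[OF assms] by blast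
qed

end
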